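(* Let $((X_i)_{i\in N},(C_i)_{i\in N})$ be a game in choice form such that for each $x\in X$ there exists $i\in N$ with $C_i(x_{-i})\neq\emptyset$. For $i\in N$ put $W_i=\{x_{-i}\in X_{-i}: C_i(x_{-i})\neq\emptyset\}$. Assume that: (a) for each $i\in N$, $X_i$ is a nonempty, convex and compact set in a Hausdorff topological vector space $E_i$, and $C_i$ is nonempty; (b) $X=\bigcup_{y\in X}\operatorname{int}_X\Big(\bigcap_{i\in N}\{x\in X:\ x_{-i}\notin W_i\ \text{ or }\ y_i\in C_i(x_{-i})\}\Big)$; (c) for each $i\in N$, $C_i(x_{-i})$ is convex or empty for each $x_{-i}\in X_{-i}$. Then the game admits an equilibrium in choice.
   Context: $N=\{1,\dots,n\}$ is a finite set of players, $X=\prod_{i\in N}X_i$, $X_{-i}=\prod_{j\neq i}X_j$ (product topologies), $x_{-i}=(x_1,\dots,x_{i-1},x_{i+1},\dots,x_n)$, and $x=(x_{-i},x_i)$. $\operatorname{int}_X$ denotes the interior in $X$. A game in choice form is a double family $((X_i)_{i\in N},(C_i)_{i\in N})$, where the $X_i$ are nonempty sets and $(C_i)_{i\in N}$ is a collection of nonempty subsets of $X$. The upper section of $C_i$ through $x_{-i}$ is $C_i(x_{-i})=\{y_i\in X_i:(x_{-i},y_i)\in C_i\}$. An element $x^*\in X$ is an equilibrium in choice if $x_i^*\in C_i(x_{-i}^* )$ for every $i\in N$ for which $C_i(x_{-i}^* )\neq\emptyset$. *)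

theory Defs
  imports "HOL-Analysis.Analysis"
begin

(* A real topological vector space is a topology on a linear subspace of an ambient real
   vector space 'a.  Nothing is assumed about 'a itself, and different topologies E i may have
   different carriers topspace (E i), none of which needs to carry the topology induced by
   another.  Hence arbitrary finite families of topological vector spaces are covered, with
   their algebraic direct sum as 'a.  Hausdorffness is not included. *)
definition top_vector_space :: "'a::real_vector topology \<Rightarrow> bool" where
  "top_vector_space E \<longleftrightarrow>
     subspace (topspace E) \<and>
     continuous_map (prod_topology E E) E (\<lambda>(x, y). x + y) \<and>
     continuous_map (prod_topology euclideanreal E) E (\<lambda>(c, x). c *\<^sub>R x)"

(* Elements of X and X_{-i} are extensional functions on {1..n} and {1..n} - {i}. *)
definition profiles :: "nat \<Rightarrow> (nat \<Rightarrow> 'a set) \<Rightarrow> (nat \<Rightarrow> 'a) set" where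
  "profiles n X = PiE {1..n} X"

definition opp_profiles :: "nat \<Rightarrow> (nat \<Rightarrow> 'a set) \<Rightarrow> nat \<Rightarrow> (nat \<Rightarrow> 'a) set" where
  "opp_profiles n X i = PiE ({1..n} - {i}) X"

definition opp :: "nat \<Rightarrow> nat \<Rightarrow> (nat \<Rightarrow> 'a) \<Rightarrow> (nat \<Rightarrow> 'a)" where
  "opp n i x = restrict x ({1..n} - {i})"

definition profile_topology ::
    "nat \<Rightarrow> (nat \<Rightarrow> 'a topology) \<Rightarrow> (nat \<Rightarrow> 'a set) \<Rightarrow> (nat \<Rightarrow> 'a) topology" where
  "profile_topology n E X = product_topology (\<lambda>i. subtopology (E i) (X i)) {1..n}"

definition game_in_choice_form ::
    "nat \<Rightarrow> (nat \<Rightarrow> 'a set) \<Rightarrow> (nat \<Rightarrow> (nat \<Rightarrow> 'a) set) \<Rightarrow> bool" where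
  "game_in_choice_form n X C \<longleftrightarrow>
     (\<forall>i\<in>{1..n}. X i \<noteq> {} \<and> C i \<noteq> {} \<and> C i \<subseteq> profiles n X)"

(* For u in X_{-i}, the profile (u, y) is u(i := y). *)
definition upper_section ::
    "(nat \<Rightarrow> 'a set) \<Rightarrow> (nat \<Rightarrow> (nat \<Rightarrow> 'a) set) \<Rightarrow> nat \<Rightarrow> (nat \<Rightarrow> 'a) \<Rightarrow> 'a set" where
  "upper_section X C i u = {y \<in> X i. u(i := y) \<in> C i}"

definition choice_domain ::
    "nat \<Rightarrow> (nat \<Rightarrow> 'a set) \<Rightarrow> (nat \<Rightarrow> (nat \<Rightarrow> 'a) set) \<Rightarrow> nat \<Rightarrow> (nat \<Rightarrow> 'a) set" where
  "choice_domain n X C i = {u \<in> opp_profiles n X i. upper_section X C i u \<noteq> {}}"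

definition equilibrium_in_choice ::
    "nat \<Rightarrow> (nat \<Rightarrow> 'a set) \<Rightarrow> (nat \<Rightarrow> (nat \<Rightarrow> 'a) set) \<Rightarrow> (nat \<Rightarrow> 'a) \<Rightarrow> bool" where
  "equilibrium_in_choice n X C x \<longleftrightarrow>
     x \<in> profiles n X \<and>
     (\<forall>i\<in>{1..n}. upper_section X C i (opp n i x) \<noteq> {} \<longrightarrow>
        x i \<in> upper_section X C i (opp n i x))"

end

theory Submission
  imports Defs "HOL-Homology.Simplices"
begin

text \<open>By compactness, finitely many of the open sets in the covering hypothesis, belonging to
  profiles \<open>y\<^sub>0, \<dots>, y\<^sub>p\<close>, already cover the space of profiles. Pull them back to an open cover
  \<open>U\<^sub>0, \<dots>, U\<^sub>p\<close> of the standard simplex along \<open>t \<mapsto> \<Sum>j\<le>p. t\<^sub>j y\<^sub>j\<close>. A partition of unity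
  subordinate to this cover is a self-map of the simplex, and Brouwer's theorem yields \<open>t\<close> lying
  in every \<open>U\<^sub>j\<close> with \<open>t\<^sub>j > 0\<close>. In the profile \<open>x\<close> given by \<open>t\<close>, the strategy of a player with
  nonempty section is then a convex combination of elements of that section, so \<open>x\<close> is an
  equilibrium. The number \<open>p\<close> is not bounded in advance, so Brouwer's theorem is derived from
  Kuhn's lemma for all dimensions inside \<open>nat \<Rightarrow> real\<close> instead of for a fixed Euclidean space.\<close>

section \<open>Brouwer's fixed point theorem for cubes of every dimension\<close>

text \<open>Padding with zeros puts the cubes of all dimensions into one type and keeps them compact
  in the product topology.\<close>

definition finite_cube :: "nat \<Rightarrow> (nat \<Rightarrow> real) set" where
  "finite_cube n = {x. (\<forall>i<n. x i \<in> {0..1}) \<and> (\<forall>i\<ge>n. x i = 0)}"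

lemma compact_finite_cube: "compact (finite_cube n)"
proof -
  have "finite_cube n = PiE UNIV (\<lambda>i. if i < n then {0..1} else {0})"
    by (force simp: finite_cube_def PiE_UNIV_domain Pi_iff split: if_splits)
  moreover have "compactin (product_topology (\<lambda>_. euclideanreal) UNIV)
      (PiE UNIV (\<lambda>i::nat. if i < n then {0..1} else {0}))"
    by (subst compactin_PiE) auto
  ultimately show ?thesis
    by (simp add: euclidean_product_topology)
qed

lemma LIMSEQ_coordinatewise:
  fixes X :: "nat \<Rightarrow> 'a \<Rightarrow> 'b::topological_space"
  shows "X \<longlonglongrightarrow> x \<longleftrightarrow> (\<forall>i. (\<lambda>n. X n i) \<longlonglongrightarrow> x i)"
  using limitin_componentwise[of "\<lambda>_. euclidean" UNIV X x sequentially]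
  by (simp add: euclidean_product_topology)

text \<open>Kuhn's lemma on the grid of mesh \<open>1/p\<close> yields one cell, with corner
  \<open>q\<close>, that contains for each coordinate \<open>i\<close> a point where
  \<open>f\<close> does not lower it and a point where \<open>f\<close> does not raise it.
  Continuity enters only when the mesh tends to 0.\<close>

lemma brouwer_finite_cube_approx:
  fixes f :: "(nat \<Rightarrow> real) \<Rightarrow> nat \<Rightarrow> real"
  assumes f: "f \<in> finite_cube n \<rightarrow> finite_cube n" and p: "0 < p"
  obtains q a b where "q \<in> finite_cube n"
    and "\<And>i. i < n \<Longrightarrow> a i \<in> finite_cube n \<and> a i i \<le> f (a i) i \<and> (\<forall>j. \<bar>a i j - q j\<bar> \<le> 1 / real p)"
    and "\<And>i. i < n \<Longrightarrow> b i \<in> finite_cube n \<and> f (b i) i \<le> b i i \<and> (\<forall>j. \<bar>b i j - q j\<bar> \<le> 1 / real p)"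
proof -
  define P :: "(nat \<Rightarrow> nat) \<Rightarrow> nat \<Rightarrow> real" where "P = (\<lambda>x i. if i < n then real (x i) / real p else 0)"
  \<comment> \<open>Label 0 at a grid point means that \<open>f\<close> does not lower coordinate
    \<open>i\<close>, label 1 that \<open>f\<close> does not raise it. Kuhn's lemma prescribes 0 on
    the face \<open>x i = 0\<close> and 1 on the face \<open>x i = p\<close>; since \<open>f\<close>
    stays in the cube, both agree with this meaning.\<close>
  define label :: "(nat \<Rightarrow> nat) \<Rightarrow> nat \<Rightarrow> nat" where
    "label = (\<lambda>x i. if x i \<noteq> p \<and> (x i = 0 \<or> P x i \<le> f (P x) i) then 0 else 1)"
  have P_cube: "P x \<in> finite_cube n" if "\<forall>i<n. x i \<le> p" for x
    using that p by (auto simp: finite_cube_def P_def)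
  have f_cube: "f (P x) i \<in> {0..1}" if "\<forall>i<n. x i \<le> p" "i < n" for x i
    using f P_cube[OF that(1)] that(2) by (auto simp: finite_cube_def)
  have below: "P x i \<le> f (P x) i" if "\<forall>i<n. x i \<le> p" "i < n" "label x i = 0" for x i
    using that f_cube[OF that(1,2)] by (auto simp: label_def P_def split: if_splits)
  have above: "f (P x) i \<le> P x i" if "\<forall>i<n. x i \<le> p" "i < n" "label x i \<noteq> 0" for x i
    using that f_cube[OF that(1,2)] p by (auto simp: label_def P_def split: if_splits)
  obtain q where q: "\<forall>i<n. q i < p"
    and rs: "\<forall>i<n. \<exists>r s. (\<forall>j<n. q j \<le> r j \<and> r j \<le> q j + 1) \<and>
      (\<forall>j<n. q j \<le> s j \<and> s j \<le> q j + 1) \<and> label r i \<noteq> label s i"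
    by (rule kuhn_lemma[of p n label]) (use p in \<open>auto simp: label_def\<close>)
  have near: "\<bar>P r j - P q j\<bar> \<le> 1 / real p" if "\<forall>j<n. q j \<le> r j \<and> r j \<le> q j + 1" for r j
    using that p by (auto simp: P_def field_simps abs_le_iff)
  have le_p: "\<forall>j<n. r j \<le> p" if "\<forall>j<n. q j \<le> r j \<and> r j \<le> q j + 1" for r
    using that q by (metis Suc_eq_plus1 Suc_leI le_trans)
  \<comment> \<open>Only the labels 0 and 1 occur, so swapping \<open>r\<close> and \<open>s\<close>
    if necessary puts the point labelled 0 first.\<close>
  have "\<exists>r s. (\<forall>j<n. q j \<le> r j \<and> r j \<le> q j + 1) \<and>
      (\<forall>j<n. q j \<le> s j \<and> s j \<le> q j + 1) \<and> label r i = 0 \<and> label s i \<noteq> 0" if "i < n" for i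
  proof -
    obtain r s where "\<forall>j<n. q j \<le> r j \<and> r j \<le> q j + 1" "\<forall>j<n. q j \<le> s j \<and> s j \<le> q j + 1"
      "label r i \<noteq> label s i"
      using rs \<open>i < n\<close> by blast
    moreover have "label r i \<in> {0, 1}" "label s i \<in> {0, 1}"
      by (auto simp: label_def)
    ultimately show ?thesis
      by (cases "label r i = 0") (metis, metis empty_iff insert_iff)
  qed
  then obtain r s where r: "\<And>i. i < n \<Longrightarrow> (\<forall>j<n. q j \<le> r i j \<and> r i j \<le> q j + 1) \<and> label (r i) i = 0"
    and s: "\<And>i. i < n \<Longrightarrow> (\<forall>j<n. q j \<le> s i j \<and> s i j \<le> q j + 1) \<and> label (s i) i \<noteq> 0"
    by metis
  show thesis
  proof (rule that[of "P q" "\<lambda>i. P (r i)" "\<lambda>i. P (s i)"])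
    show "P q \<in> finite_cube n"
      using q by (intro P_cube) (auto simp: less_imp_le)
  qed (use r s P_cube below above near le_p in \<open>simp_all\<close>)
qed

text \<open>Let the mesh tend to 0. The cells shrink to a limit point \<open>x\<close>, where
  continuity turns the two approximate inequalities into \<open>x i \<le> f x i\<close> and
  \<open>f x i \<le> x i\<close>.\<close>

theorem brouwer_finite_cube:
  fixes f :: "(nat \<Rightarrow> real) \<Rightarrow> nat \<Rightarrow> real"
  assumes cont: "continuous_on (finite_cube n) f" and f: "f \<in> finite_cube n \<rightarrow> finite_cube n"
  obtains x where "x \<in> finite_cube n" "f x = x"
proof -
  have "\<forall>p. \<exists>q a b. q \<in> finite_cube n \<and>
     (\<forall>i<n. a i \<in> finite_cube n \<and> a i i \<le> f (a i) i \<and> (\<forall>j. \<bar>a i j - q j\<bar> \<le> 1 / real (Suc p))) \<and>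
     (\<forall>i<n. b i \<in> finite_cube n \<and> f (b i) i \<le> b i i \<and> (\<forall>j. \<bar>b i j - q j\<bar> \<le> 1 / real (Suc p)))"
    (is "\<forall>p. \<exists>q a b. ?P p q a b")
  proof
    fix p show "\<exists>q a b. ?P p q a b"
      by (rule brouwer_finite_cube_approx[OF f, of "Suc p"]) (simp, blast)
  qed
  then obtain q a b where q: "\<And>p. q p \<in> finite_cube n"
    and a: "\<And>p i. i < n \<Longrightarrow> a p i \<in> finite_cube n \<and> a p i i \<le> f (a p i) i \<and>
      (\<forall>j. \<bar>a p i j - q p j\<bar> \<le> 1 / real (Suc p))"
    and b: "\<And>p i. i < n \<Longrightarrow> b p i \<in> finite_cube n \<and> f (b p i) i \<le> b p i i \<and>
      (\<forall>j. \<bar>b p i j - q p j\<bar> \<le> 1 / real (Suc p))"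
    by metis
  \<comment> \<open>One subsequence serves all coordinates: every \<open>a p i\<close> and
    \<open>b p i\<close> stays within \<open>1 / Suc p\<close> of the same corner
    \<open>q p\<close>.\<close>
  obtain x \<sigma> where x: "x \<in> finite_cube n" and \<sigma>: "strict_mono \<sigma>" and lim: "(q \<circ> \<sigma>) \<longlonglongrightarrow> x"
    using compact_imp_seq_compact[OF compact_finite_cube] q unfolding seq_compact_def by metis
  have small: "(\<lambda>k. 1 / real (Suc (\<sigma> k))) \<longlonglongrightarrow> 0"
    using LIMSEQ_subseq_LIMSEQ[OF lim_1_over_n[THEN LIMSEQ_Suc] \<sigma>] by (simp add: o_def)
  have lim_near: "(\<lambda>k. c (\<sigma> k)) \<longlonglongrightarrow> x"
    if "\<And>p j. \<bar>c p j - q p j\<bar> \<le> 1 / real (Suc p)" for c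
    unfolding LIMSEQ_coordinatewise
  proof
    fix j
    have "(\<lambda>k. c (\<sigma> k) j - q (\<sigma> k) j) \<longlonglongrightarrow> 0"
      by (rule Lim_null_comparison[OF _ small]) (use that in auto)
    moreover have "(\<lambda>k. q (\<sigma> k) j) \<longlonglongrightarrow> x j"
      using lim by (simp add: LIMSEQ_coordinatewise o_def)
    ultimately show "(\<lambda>k. c (\<sigma> k) j) \<longlonglongrightarrow> x j"
      using tendsto_add by fastforce
  qed
  have lim_f: "(\<lambda>k. f (c (\<sigma> k)) i) \<longlonglongrightarrow> f x i"
    if "(\<lambda>k. c (\<sigma> k)) \<longlonglongrightarrow> x" "\<And>p. c p \<in> finite_cube n" for c i
    using continuous_on_tendsto_compose[OF cont that(1) x] that(2)
    by (simp add: LIMSEQ_coordinatewise)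
  have "f x i = x i" for i
  proof (cases "i < n")
    case True
    have la: "(\<lambda>k. a (\<sigma> k) i) \<longlonglongrightarrow> x" and lb: "(\<lambda>k. b (\<sigma> k) i) \<longlonglongrightarrow> x"
      using lim_near[of "\<lambda>p. a p i"] lim_near[of "\<lambda>p. b p i"] a[OF True] b[OF True] by auto
    have "x i \<le> f x i"
      by (rule LIMSEQ_le[where X = "\<lambda>k. a (\<sigma> k) i i", OF _ lim_f[OF la]])
        (use la a[OF True] in \<open>auto simp: LIMSEQ_coordinatewise\<close>)
    moreover have "f x i \<le> x i"
      by (rule LIMSEQ_le[where Y = "\<lambda>k. b (\<sigma> k) i i", OF lim_f[OF lb]])
        (use lb b[OF True] in \<open>auto simp: LIMSEQ_coordinatewise\<close>)
    ultimately show ?thesis by simp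
  next
    \<comment> \<open>Both sides are 0 here by the zero padding of the cube.\<close>
    case False
    then show ?thesis
      using funcset_mem[OF f x] x by (simp add: finite_cube_def)
  qed
  then show thesis using that x by auto
qed

section \<open>From cubes to simplices and their open covers\<close>

lemma continuous_on_coordinate: "continuous_on S (\<lambda>x. x i)"
  by (rule continuous_on_subset[OF continuous_on_product_coordinates]) simp

text \<open>A fixed point of \<open>f \<circ> r\<close> is a value of \<open>f\<close>, so it lies
  in the simplex, where \<open>r\<close> is the identity. The map \<open>r\<close> divides by the
  coordinate sum if this exceeds 1, and otherwise adds the missing mass to coordinate 0.\<close>

theorem brouwer_standard_simplex:
  assumes cont: "continuous_on (standard_simplex p) f"
    and f: "f \<in> standard_simplex p \<rightarrow> standard_simplex p"
  obtains x where "x \<in> standard_simplex p" "f x = x"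
proof -
  \<comment> \<open>a retraction of the cube onto the simplex\<close>
  define r :: "(nat \<Rightarrow> real) \<Rightarrow> nat \<Rightarrow> real" where
    "r = (\<lambda>t i. t i / max 1 (\<Sum>j\<le>p. t j) + (if i = 0 then max 0 (1 - (\<Sum>j\<le>p. t j)) else 0))"
  \<comment> \<open>The coordinates of the simplex run from 0 to \<open>p\<close>, hence the cube
    dimension \<open>Suc p\<close>.\<close>
  have r_simplex: "r t \<in> standard_simplex p" if t: "t \<in> finite_cube (Suc p)" for t
  proof -
    have "0 \<le> t i" for i
      using t by (cases "i < Suc p") (auto simp: finite_cube_def)
    then have nonneg: "0 \<le> r t i" for i
      by (simp add: r_def)
    have sum: "(\<Sum>i\<le>p. r t i) = 1"
      by (auto simp: r_def sum.distrib sum_divide_distrib[symmetric] max_def)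
    have "r t i \<le> 1" if "i \<le> p" for i
      using member_le_sum[of i "{..p}" "r t"] nonneg sum that by auto
    moreover have "r t i = 0" if "i > p" for i
      using that t by (auto simp: r_def finite_cube_def)
    ultimately show ?thesis
      using nonneg sum by (fastforce simp: standard_simplex_def not_le[symmetric])
  qed
  have r_id: "r t = t" if "t \<in> standard_simplex p" for t
    using that by (auto simp: r_def standard_simplex_def)
  have sub: "standard_simplex p \<subseteq> finite_cube (Suc p)"
    by (auto simp: standard_simplex_def finite_cube_def)
  have "continuous_on (finite_cube (Suc p)) (\<lambda>t. r t i)" for i
    unfolding r_def
    by (cases "i = 0") (auto intro!: continuous_intros continuous_on_coordinate)
  then have "continuous_on (finite_cube (Suc p)) r"
    by (rule continuous_on_coordinatewise_then_product)
  then have "continuous_on (finite_cube (Suc p)) (f \<circ> r)"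
    by (intro continuous_on_compose continuous_on_subset[OF cont]) (auto simp: r_simplex)
  then obtain x where x: "x \<in> finite_cube (Suc p)" "(f \<circ> r) x = x"
    by (rule brouwer_finite_cube) (use f r_simplex sub in fastforce)
  then have "x \<in> standard_simplex p"
    using f r_simplex by (metis comp_apply funcset_mem)
  then show thesis
    using that x r_id by auto
qed

text \<open>The distances to the complements of the \<open>U j\<close>, divided by their sum, form a
  continuous self-map \<open>g\<close> of the simplex. At a fixed point \<open>t j\<close> is itself
  such a weight, so \<open>0 < t j\<close> forces \<open>t\<close> to have positive distance from
  the complement of \<open>U j\<close>.\<close>

theorem dual_KKM:
  assumes op: "\<And>j. j \<le> p \<Longrightarrow> openin (top_of_set (standard_simplex p)) (U j)"
    and cover: "standard_simplex p \<subseteq> (\<Union>j\<le>p. U j)"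
  obtains t where "t \<in> standard_simplex p" "\<And>j. j \<le> p \<Longrightarrow> 0 < t j \<Longrightarrow> t \<in> U j"
proof -
  let ?\<Delta> = "standard_simplex p"
  define \<omega> :: "nat \<Rightarrow> real" where "\<omega> = (\<lambda>_. 2)"
  have \<omega>: "\<omega> \<notin> ?\<Delta>"
    by (auto simp: \<omega>_def standard_simplex_def)
  \<comment> \<open>The extra point \<open>\<omega>\<close> keeps the sets nonempty; \<open>infdist x {}\<close> would be \<open>0\<close>.\<close>
  define A where "A = (\<lambda>j. insert \<omega> (?\<Delta> - U j))"
  define d where "d = (\<lambda>j t. infdist t (A j))"
  have "compact ?\<Delta>"
    using compactin_standard_simplex[of p] by (simp add: euclidean_product_topology)
  then have "closed ?\<Delta>"
    by (rule compact_imp_closed)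
  then have closed_A: "closed (A j)" if "j \<le> p" for j
    using op[OF that] unfolding A_def
    by (intro closed_insert) (metis closedin_closed_trans closedin_diff closedin_topspace topspace_euclidean_subtopology)
  \<comment> \<open>As \<open>\<omega>\<close> is off the simplex, a simplex point lies in
    \<open>A j\<close> exactly when it lies outside \<open>U j\<close>; and the distance to a
    nonempty closed set vanishes only on that set.\<close>
  have d_pos: "0 < d j t \<longleftrightarrow> t \<in> U j" if "j \<le> p" "t \<in> ?\<Delta>" for j t
    using in_closed_iff_infdist_zero[OF closed_A[OF that(1)], of t] \<omega> that infdist_nonneg[of t "A j"]
    by (auto simp: A_def d_def less_le)
  have d_nonneg: "0 \<le> d j t" for j t
    by (simp add: d_def infdist_nonneg)
  have sum_pos: "0 < (\<Sum>j\<le>p. d j t)" if "t \<in> ?\<Delta>" for t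
  proof -
    obtain j where "j \<le> p" "t \<in> U j" using cover \<open>t \<in> ?\<Delta>\<close> by auto
    then have "0 < d j t"
      using d_pos that by blast
    then show ?thesis
      using d_nonneg \<open>j \<le> p\<close> by (intro sum_pos2[of _ j]) simp_all
  qed
  \<comment> \<open>The value 0 beyond \<open>p\<close> is what membership in
    \<open>standard_simplex p\<close> demands.\<close>
  define g where "g = (\<lambda>t j. if j \<le> p then d j t / (\<Sum>k\<le>p. d k t) else 0)"
  have "continuous_on ?\<Delta> (\<lambda>t. g t j)" for j
    unfolding g_def d_def using sum_pos
    by (cases "j \<le> p") (auto intro!: continuous_intros simp: d_def dest!: sum_pos)
  then have "continuous_on ?\<Delta> g"
    by (rule continuous_on_coordinatewise_then_product)
  moreover have "g \<in> ?\<Delta> \<rightarrow> ?\<Delta>"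
  proof
    fix t assume "t \<in> ?\<Delta>"
    then have s: "0 < (\<Sum>j\<le>p. d j t)" by (rule sum_pos)
    have "d i t \<le> (\<Sum>j\<le>p. d j t)" if "i \<le> p" for i
      using that d_nonneg by (intro member_le_sum) auto
    then show "g t \<in> ?\<Delta>"
      using s d_nonneg by (auto simp: g_def standard_simplex_def sum_divide_distrib[symmetric])
  qed
  ultimately obtain t where t: "t \<in> ?\<Delta>" "g t = t"
    by (rule brouwer_standard_simplex)
  show thesis
  proof (rule that[OF t(1)])
    fix j assume "j \<le> p" "0 < t j"
    then have "0 < g t j" using t(2) by simp
    then show "t \<in> U j"
      using d_pos[OF \<open>j \<le> p\<close> t(1)] sum_pos[OF t(1)] \<open>j \<le> p\<close> by (simp add: g_def zero_less_divide_iff)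
  qed
qed

section \<open>Mixtures of profiles and the equilibrium\<close>

text \<open>This makes the mixing map from the simplex into the profiles continuous. The space
  \<open>E\<close> is a topology on a subspace and not a type class instance, so the sum is built up
  by composing with its two continuous operations.\<close>

lemma continuous_map_tvs_sum:
  assumes E: "top_vector_space E" and J: "finite J"
    and y: "\<And>j. j \<in> J \<Longrightarrow> y j \<in> topspace E"
    and c: "\<And>j. j \<in> J \<Longrightarrow> continuous_map T euclideanreal (c j)"
  shows "continuous_map T E (\<lambda>t. \<Sum>j\<in>J. c j t *\<^sub>R y j)"
  using J y c
proof (induction J)
  case empty
  then show ?case
    using E by (simp add: top_vector_space_def subspace_def)
next
  case (insert k J)
  have add: "continuous_map (prod_topology E E) E (\<lambda>(x, y). x + y)"
    and scale: "continuous_map (prod_topology euclideanreal E) E (\<lambda>(c, x). c *\<^sub>R x)"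
    using E by (auto simp: top_vector_space_def)
  have "continuous_map T (prod_topology euclideanreal E) (\<lambda>t. (c k t, y k))"
    using insert.prems by (simp add: continuous_map_pairedI)
  from continuous_map_compose[OF this scale]
  have "continuous_map T E (\<lambda>t. c k t *\<^sub>R y k)"
    by (simp add: o_def)
  moreover have "continuous_map T E (\<lambda>t. \<Sum>j\<in>J. c j t *\<^sub>R y j)"
    using insert by auto
  ultimately have "continuous_map T (prod_topology E E) (\<lambda>t. (c k t *\<^sub>R y k, \<Sum>j\<in>J. c j t *\<^sub>R y j))"
    by (rule continuous_map_pairedI)
  from continuous_map_compose[OF this add] show ?case
    using insert.hyps by (simp add: o_def)
qed

theorem theorem4:
  fixes n :: nat
    and E :: "nat \<Rightarrow> 'a::real_vector topology"
    and X :: "nat \<Rightarrow> 'a set"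
    and C :: "nat \<Rightarrow> (nat \<Rightarrow> 'a) set"
  assumes game: "game_in_choice_form n X C"
    and nonempty_section:
      "\<And>x. x \<in> profiles n X \<Longrightarrow> \<exists>i\<in>{1..n}. upper_section X C i (opp n i x) \<noteq> {}"
    and tvs: "\<And>i. i \<in> {1..n} \<Longrightarrow> top_vector_space (E i) \<and> Hausdorff_space (E i)"
    and strategies:
      "\<And>i. i \<in> {1..n} \<Longrightarrow> X i \<noteq> {} \<and> convex (X i) \<and> compactin (E i) (X i)"
    and choices_nonempty: "\<And>i. i \<in> {1..n} \<Longrightarrow> C i \<noteq> {}"
    and cover:
      "profiles n X =
         (\<Union>y\<in>profiles n X. profile_topology n E X interior_of
            (\<Inter>i\<in>{1..n}. {x \<in> profiles n X.
               opp n i x \<notin> choice_domain n X C i \<or> y i \<in> upper_section X C i (opp n i x)}))"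
    and convex_sections:
      "\<And>i u. \<lbrakk>i \<in> {1..n}; u \<in> opp_profiles n X i\<rbrakk> \<Longrightarrow>
         convex (upper_section X C i u) \<or> upper_section X C i u = {}"
  shows "\<exists>x. equilibrium_in_choice n X C x"
proof -
  let ?T = "profile_topology n E X" and ?\<Delta> = standard_simplex
  \<comment> \<open>\<open>F y\<close> collects the profiles against which \<open>y i\<close> is an
    admissible choice for every player \<open>i\<close> whose section is nonempty.\<close>
  define F where "F = (\<lambda>y. \<Inter>i\<in>{1..n}. {x \<in> profiles n X.
    opp n i x \<notin> choice_domain n X C i \<or> y i \<in> upper_section X C i (opp n i x)})"
  define G where "G = (\<lambda>y. ?T interior_of F y)"
  have X_sub: "X i \<subseteq> topspace (E i)" if "i \<in> {1..n}" for i
    using strategies[OF that] compactin_subset_topspace by blast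
  have space: "topspace ?T = profiles n X"
    unfolding profile_topology_def topspace_product_topology profiles_def
    using X_sub by (intro PiE_cong) auto
  have "compact_space ?T"
    unfolding profile_topology_def compact_space_product_topology
    using strategies by (auto intro: compact_space_subtopology)
  moreover have "profiles n X = (\<Union>y\<in>profiles n X. G y)"
    using cover by (simp add: G_def F_def)
  ultimately obtain Y where Y: "finite Y" "Y \<subseteq> profiles n X" "profiles n X \<subseteq> (\<Union>y\<in>Y. G y)"
    unfolding compact_space_alt space
    by (smt (verit) G_def finite_subset_image image_iff openin_interior_of order_refl)
  \<comment> \<open>Nonemptiness makes \<open>card Y\<close> a successor, so that \<open>Y\<close>
    can be indexed by the vertices \<open>0, ..., p\<close> of a simplex.\<close>
  have "profiles n X \<noteq> {}"
    using strategies by (auto simp: profiles_def PiE_eq_empty_iff)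
  then have "Y \<noteq> {}"
    using Y by auto
  then obtain p where p: "card Y = Suc p"
    using Y(1) by (metis card_0_eq not0_implies_Suc)
  obtain y where "bij_betw y {0..<card Y} Y"
    using ex_bij_betw_nat_finite[OF Y(1)] by blast
  then have y_image: "y ` {..p} = Y"
    by (simp add: bij_betw_def p atLeast0LessThan lessThan_Suc_atMost)
  then have y: "y j i \<in> X i" if "j \<le> p" "i \<in> {1..n}" for i j
    using that Y(2) by (fastforce simp: profiles_def PiE_iff)
  \<comment> \<open>All players mix the profiles \<open>y j\<close> with the same weights
    \<open>t\<close>; convexity of each \<open>X i\<close> keeps the result a profile.\<close>
  define h where "h = (\<lambda>t. \<lambda>i\<in>{1..n}. \<Sum>j\<le>p. t j *\<^sub>R y j i)"
  have h_profile: "h t \<in> profiles n X" if "t \<in> ?\<Delta> p" for t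
    using that y strategies
    by (auto simp: h_def profiles_def standard_simplex_def intro!: convex_sum)
  have h_cont: "continuous_map (top_of_set (?\<Delta> p)) ?T h"
    unfolding profile_topology_def
  proof (rule continuous_map_coordinatewise_then_product)
    fix i assume i: "i \<in> {1..n}"
    have "continuous_map (top_of_set (?\<Delta> p)) (E i) (\<lambda>t. \<Sum>j\<le>p. t j *\<^sub>R y j i)"
      using tvs[OF i] X_sub[OF i] y i
      by (intro continuous_map_tvs_sum)
        (auto intro: continuous_on_coordinate)
    then show "continuous_map (top_of_set (?\<Delta> p)) (subtopology (E i) (X i)) (\<lambda>t. h t i)"
      using h_profile i
      by (auto simp: continuous_map_in_subtopology h_def profiles_def PiE_iff)
  qed (auto simp: h_def)
  define U where "U = (\<lambda>j. {t \<in> ?\<Delta> p. h t \<in> G (y j)})"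
  obtain t where t: "t \<in> ?\<Delta> p" "\<And>j. j \<le> p \<Longrightarrow> 0 < t j \<Longrightarrow> t \<in> U j"
  proof (rule dual_KKM[of p U])
    show "openin (top_of_set (?\<Delta> p)) (U j)" for j
      using openin_continuous_map_preimage[OF h_cont, of "G (y j)"] by (simp add: U_def G_def)
    show "?\<Delta> p \<subseteq> (\<Union>j\<le>p. U j)"
      using h_profile Y(3) y_image by (fastforce simp: U_def)
  qed auto
  have "h t i \<in> upper_section X C i (opp n i (h t))"
    if i: "i \<in> {1..n}" and ne: "upper_section X C i (opp n i (h t)) \<noteq> {}" for i
  proof -
    let ?S = "upper_section X C i (opp n i (h t))"
    have u: "opp n i (h t) \<in> opp_profiles n X i"
      using h_profile[OF t(1)] by (auto simp: opp_def opp_profiles_def profiles_def)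
    \<comment> \<open>A positive weight puts \<open>h t\<close> into \<open>G (y j)\<close>, hence
      into \<open>F (y j)\<close>. Since the section of player \<open>i\<close> is nonempty, only
      the second alternative in \<open>F\<close> remains.\<close>
    have yS: "y j i \<in> ?S" if "j \<le> p" "0 < t j" for j
    proof -
      have "h t \<in> F (y j)"
        using t(2)[OF that] interior_of_subset by (fastforce simp: U_def G_def)
      then show ?thesis
        using i ne u by (auto simp: F_def choice_domain_def)
    qed
    \<comment> \<open>Membership in the section is known only for indices of positive weight, so
      convexity is applied to these; the omitted terms are zero and do not change the sum
      \<open>h t i\<close>.\<close>
    have "(\<Sum>j\<in>{j. j \<le> p \<and> 0 < t j}. t j *\<^sub>R y j i) \<in> ?S"
    proof (rule convex_sum)
      show "(\<Sum>j\<in>{j. j \<le> p \<and> 0 < t j}. t j) = 1"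
        using t(1) by (subst sum.mono_neutral_left[of "{..p}"]) (auto simp: standard_simplex_def order_less_le)
    qed (use convex_sections[OF i u] ne yS in auto)
    also have "(\<Sum>j\<in>{j. j \<le> p \<and> 0 < t j}. t j *\<^sub>R y j i) = h t i"
      using t(1) i by (simp add: h_def, intro sum.mono_neutral_left) (auto simp: standard_simplex_def order_less_le)
    finally show ?thesis .
  qed
  then show ?thesis
    using h_profile[OF t(1)] unfolding equilibrium_in_choice_def by blast
qed

end
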